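(* Let $n\ge 1$ be an integer and let $F:[t_0,\infty)\times\mathbb{R}\to\mathbb{R}$ be continuous. Assume: (i) for some number $\nu>1$, $$\frac{F(\cdot,f(\cdot))}{|f(\cdot)|^{\nu}}\in\mathcal S_1\quad\text{for all } f\in\mathcal S_1;$$ (ii) there are constants $\mu>1$ and $c>-n$ such that for all $f\in\mathcal S_3$ one has $F(\cdot,f(\cdot))\in\mathcal S_3$ and $$\Pi(F(\cdot,f(\cdot)))\ge \mu\,\Pi(f)+c .$$ Let $y$ be a solution of the $n$th-order differential equation $y^{(n)}=F(t,y)$. Then there exists an integer $i$ $(0\le i\le n)$ such that for each integer $j$ $(i\le j\le n)$ an increasing sequence $\{t_k\}$ can be chosen such that $t_k\to\infty$ and $\lim_{k\to\infty}y^{(j)}(t_k)=0$.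
   Context: All functions of $t$ are continuous and real-valued, with domains that are intervals of the type $[a,\infty)$, where $a$ may depend on the function; $\liminf$ and $\limsup$ are taken as $t\to+\infty$. Such functions are divided into three classes: - $\mathcal S_1$ is the set of all $f$ such that $\liminf |f(t)|/t^p=\infty$ for all real numbers $p$. - $\mathcal S_2$ is the set of all $f$ such that $\limsup |f(t)|/t^p=0$ for all real numbers $p$. - $\mathcal S_3$ is the set of all $f$ belonging neither to $\mathcal S_1$ nor to $\mathcal S_2$. For $f\in\mathcal S_3$, $\Pi(f)$ is the number such that for all $\epsilon>0$ $$\liminf \frac{|f(t)|}{t^{\Pi(f)-\epsilon}}=\infty\quad\text{and}\quad \liminf\frac{|f(t)|}{t^{\Pi(f)+\epsilon}}=0;$$ if there is no such number (i.e. $\liminf |f(t)|/t^p=0$ for all real $p$), put $\Pi(f)=-\infty$. Inequalities involving $\Pi$ are understood in the extended reals, with $\mu\cdot(-\infty)+c=-\infty$. Membership in these classes and the value $\Pi(f)$ depend only on behavior for large $t$; $F(\cdot,f(\cdot))$ denotes the function $t\mapsto F(t,f(t))$, and this function and the quotient in (i) are considered on some interval $[a',\infty)$ on which they are defined (any $f\in\mathcal S_1$ is nonzero for all sufficiently large $t$). A solution of $y^{(n)}=F(t,y)$ is an $n$ times continuously differentiable function $y$ on some interval $[a,\infty)$ (with $a\ge t_0$) satisfying $y^{(n)}(t)=F(t,y(t))$ for all $t\in[a,\infty)$. *)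

theory Defs
  imports "HOL-Analysis.Analysis"
begin

text \<open>
  A function with domain \<open>[a, \<infinity>)\<close> is represented by a total function whose values
  below some bound are irrelevant: all notions below depend only on the germ at \<open>+\<infinity>\<close>.
  Since \<open>t\<close> tends to \<open>+\<infinity>\<close>, the real power \<open>t powr p\<close> is only
  relevant for \<open>t > 0\<close>.
\<close>

definition eventually_continuous :: "(real \<Rightarrow> real) \<Rightarrow> bool" where
  "eventually_continuous f \<longleftrightarrow> (\<exists>a. continuous_on {a..} f)"

definition S1 :: "(real \<Rightarrow> real) set" where
  "S1 = {f. eventually_continuous f \<and>
     (\<forall>p::real. Liminf at_top (\<lambda>t. ereal (\<bar>f t\<bar> / t powr p)) = \<infinity>)}"

definition S2 :: "(real \<Rightarrow> real) set" where
  "S2 = {f. eventually_continuous f \<and>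
     (\<forall>p::real. Limsup at_top (\<lambda>t. ereal (\<bar>f t\<bar> / t powr p)) = 0)}"

definition S3 :: "(real \<Rightarrow> real) set" where
  "S3 = {f. eventually_continuous f \<and> f \<notin> S1 \<and> f \<notin> S2}"

definition has_growth_exponent :: "(real \<Rightarrow> real) \<Rightarrow> real \<Rightarrow> bool" where
  "has_growth_exponent f q \<longleftrightarrow>
     (\<forall>\<epsilon>>0. Liminf at_top (\<lambda>t. ereal (\<bar>f t\<bar> / t powr (q - \<epsilon>))) = \<infinity> \<and>
             Liminf at_top (\<lambda>t. ereal (\<bar>f t\<bar> / t powr (q + \<epsilon>))) = 0)"

text \<open>
  The quantity \<open>\<Pi>(f)\<close>, meaningful for \<open>f \<in> S3\<close>. Both conditions in
  \<^const>\<open>has_growth_exponent\<close> use the lower limit, so such a number is unique if it exists.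
\<close>

definition growth_exponent :: "(real \<Rightarrow> real) \<Rightarrow> ereal" where
  "growth_exponent f =
     (if \<exists>q. has_growth_exponent f q then ereal (THE q. has_growth_exponent f q) else - \<infinity>)"

text \<open>Iterated derivatives on \<open>[a, \<infinity>)\<close>, one-sided at the endpoint \<open>a\<close>.\<close>

primrec nth_deriv_on :: "real \<Rightarrow> nat \<Rightarrow> (real \<Rightarrow> real) \<Rightarrow> real \<Rightarrow> real" where
  "nth_deriv_on a 0 y = y"
| "nth_deriv_on a (Suc j) y = (\<lambda>t. vector_derivative (nth_deriv_on a j y) (at t within {a..}))"

definition C_n_on :: "real \<Rightarrow> nat \<Rightarrow> (real \<Rightarrow> real) \<Rightarrow> bool" where
  "C_n_on a n y \<longleftrightarrow>
     (\<forall>j<n. nth_deriv_on a j y differentiable_on {a..}) \<and>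
     continuous_on {a..} (nth_deriv_on a n y)"

definition ode_solution :: "nat \<Rightarrow> real \<Rightarrow> (real \<Rightarrow> real \<Rightarrow> real) \<Rightarrow> real \<Rightarrow> (real \<Rightarrow> real) \<Rightarrow> bool" where
  "ode_solution n t0 F a y \<longleftrightarrow>
     t0 \<le> a \<and> C_n_on a n y \<and> (\<forall>t\<ge>a. nth_deriv_on a n y t = F t (y t))"

end

theory Submission
  imports Defs "HOL-Real_Asymp.Real_Asymp"
begin

text \<open>
  If \<open>y\<^sup>(\<^sup>n\<^sup>)\<close> had no sequence of values tending to \<open>0\<close>, it would be bounded away from \<open>0\<close>
  with constant sign, so that, up to sign, all lower derivatives are eventually positive and
  \<open>y\<close> grows at least like \<open>t\<^sup>n\<close>; in particular \<open>y \<notin> S2\<close>. If \<open>y \<in> S3\<close> has exponent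
  \<open>q \<ge> n\<close>, then integrating \<open>n\<close> times the lower bound on \<open>F(t, y)\<close> gives growth of
  exponent at least \<open>\<mu> q + c + n > q\<close>. If \<open>y \<in> S1\<close>, then
  \<open>y\<^sup>(\<^sup>n\<^sup>) \<ge> y\<^sup>\<nu>\<close> forces a blow-up in finite time.
  So \<open>i = n\<close> always works.
\<close>

section \<open>Lower limits and eventual power bounds\<close>

lemma Liminf_eq_PInf_iff:
  fixes f :: "real \<Rightarrow> real"
  shows "Liminf at_top (\<lambda>t. ereal (f t)) = \<infinity> \<longleftrightarrow> filterlim f at_top at_top"
  by (simp add: Liminf_PInfty[symmetric] tendsto_PInfty_eq_at_top)

text \<open>The quotient dominates \<open>K * t powr (r - s)\<close>, so the strict drop in exponent
  absorbs any positive constant. With the next lemma this translates between infinite lower limits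
  and eventual bounds.\<close>

lemma powr_bound_imp_Liminf:
  fixes g :: "real \<Rightarrow> real"
  assumes "K > 0" "eventually (\<lambda>t. K * t powr r \<le> \<bar>g t\<bar>) at_top" "s < r"
  shows "Liminf at_top (\<lambda>t. ereal (\<bar>g t\<bar> / t powr s)) = \<infinity>"
proof -
  have "filterlim (\<lambda>t::real. t powr (r - s)) at_top at_top"
    using real_powr_at_top assms(3) by simp
  then have "filterlim (\<lambda>t::real. K * t powr (r - s)) at_top at_top"
    using assms(1) filterlim_tendsto_pos_mult_at_top[OF tendsto_const] by blast
  moreover have "eventually (\<lambda>t. K * t powr (r - s) \<le> \<bar>g t\<bar> / t powr s) at_top"
    using assms(2) eventually_gt_at_top[of 0]
    by eventually_elim (simp add: powr_diff divide_right_mono)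
  ultimately have "filterlim (\<lambda>t. \<bar>g t\<bar> / t powr s) at_top at_top"
    by (rule filterlim_at_top_mono)
  then show ?thesis by (simp add: Liminf_eq_PInf_iff)
qed

lemma Liminf_imp_powr_bound:
  fixes g :: "real \<Rightarrow> real"
  assumes "Liminf at_top (\<lambda>t. ereal (\<bar>g t\<bar> / t powr s)) = \<infinity>"
  shows "eventually (\<lambda>t. t powr s \<le> \<bar>g t\<bar>) at_top"
proof -
  have "eventually (\<lambda>t. 1 \<le> \<bar>g t\<bar> / t powr s) at_top"
    using assms by (simp add: Liminf_eq_PInf_iff filterlim_at_top)
  then show ?thesis
    using eventually_gt_at_top[of 0] by eventually_elim (simp add: field_simps)
qed

lemma Liminf_PInf_mono:
  fixes g :: "real \<Rightarrow> real"
  assumes "Liminf at_top (\<lambda>t. ereal (\<bar>g t\<bar> / t powr r)) = \<infinity>" "s \<le> r"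
  shows "Liminf at_top (\<lambda>t. ereal (\<bar>g t\<bar> / t powr s)) = \<infinity>"
proof (cases "s = r")
  case False
  then show ?thesis
    using powr_bound_imp_Liminf[of 1 r g s] Liminf_imp_powr_bound[OF assms(1)] assms(2) by simp
qed (use assms in simp)

text \<open>A positive lower limit at \<open>r\<close> would give an eventual bound
  \<open>K * t powr r\<close>, hence an infinite lower limit at every smaller exponent, in
  particular at \<open>s\<close>.\<close>

lemma Liminf_zero:
  fixes g :: "real \<Rightarrow> real"
  assumes "Liminf at_top (\<lambda>t. ereal (\<bar>g t\<bar> / t powr s)) \<noteq> \<infinity>" "s < r"
  shows "Liminf at_top (\<lambda>t. ereal (\<bar>g t\<bar> / t powr r)) = 0"
proof (rule antisym)
  show "0 \<le> Liminf at_top (\<lambda>t. ereal (\<bar>g t\<bar> / t powr r))"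
    by (rule Liminf_bounded) simp
  show "Liminf at_top (\<lambda>t. ereal (\<bar>g t\<bar> / t powr r)) \<le> 0"
  proof (rule ccontr)
    assume "\<not> ?thesis"
    then obtain K where K: "0 < ereal K" "ereal K < Liminf at_top (\<lambda>t. ereal (\<bar>g t\<bar> / t powr r))"
      using ereal_dense2[of 0] by (auto simp: not_le)
    have "eventually (\<lambda>t. K < \<bar>g t\<bar> / t powr r) at_top"
      using less_LiminfD[OF K(2)] by simp
    then have "eventually (\<lambda>t. K * t powr r \<le> \<bar>g t\<bar>) at_top"
      using eventually_gt_at_top[of 0] by eventually_elim (simp add: field_simps)
    then show False
      using powr_bound_imp_Liminf[of K r g s] K(1) assms by simp
  qed
qed

lemma has_growth_exponent_unique:
  assumes "has_growth_exponent f q" "has_growth_exponent f q'"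
  shows "q = q'"
proof -
  have False if "has_growth_exponent f x" "has_growth_exponent f y" "x < y" for x y
  proof -
    \<comment> \<open>With half the gap, \<open>y - e\<close> and \<open>x + e\<close> are the same
      midpoint, where the lower limit would be both infinite and zero.\<close>
    define e where "e = (y - x) / 2"
    have e: "e > 0" "y - e = x + e" using that(3) by (auto simp: e_def field_simps)
    have "Liminf at_top (\<lambda>t. ereal (\<bar>f t\<bar> / t powr (y - e))) = \<infinity>"
      using that(2) e(1) unfolding has_growth_exponent_def by blast
    moreover have "Liminf at_top (\<lambda>t. ereal (\<bar>f t\<bar> / t powr (x + e))) = 0"
      using that(1) e(1) unfolding has_growth_exponent_def by blast
    ultimately show False using e(2) by simp
  qed
  then show ?thesis using assms by (metis linorder_neqE)
qed

lemma growth_exponent_eq: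
  assumes "has_growth_exponent f q"
  shows "growth_exponent f = ereal q"
proof -
  have "(THE q. has_growth_exponent f q) = q"
    using assms has_growth_exponent_unique by blast
  then show ?thesis using assms by (auto simp: growth_exponent_def)
qed

text \<open>The exponents with infinite lower limit form a downward closed set; the two assumptions
  make it nonempty and bounded above, and its supremum is the required number.\<close>

lemma has_growth_exponent_exists:
  assumes "Liminf at_top (\<lambda>t. ereal (\<bar>f t\<bar> / t powr p)) = \<infinity>"
    and "Liminf at_top (\<lambda>t. ereal (\<bar>f t\<bar> / t powr p')) \<noteq> \<infinity>"
  shows "\<exists>q. has_growth_exponent f q"
proof -
  define P where "P = {p. Liminf at_top (\<lambda>t. ereal (\<bar>f t\<bar> / t powr p)) = \<infinity>}"
  have "P \<noteq> {}" using assms(1) P_def by auto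
  have "x \<le> p'" if "x \<in> P" for x
    using that assms(2) Liminf_PInf_mono[of f x p'] by (cases "x \<le> p'") (auto simp: P_def)
  then have bdd: "bdd_above P" by (rule bdd_aboveI)
  have "has_growth_exponent f (Sup P)"
    unfolding has_growth_exponent_def
  proof (intro allI impI conjI)
    fix e :: real assume "e > 0"
    then obtain x where "x \<in> P" "Sup P - e < x"
      using less_cSupE[of "Sup P - e" P] \<open>P \<noteq> {}\<close> by auto
    then show "Liminf at_top (\<lambda>t. ereal (\<bar>f t\<bar> / t powr (Sup P - e))) = \<infinity>"
      using Liminf_PInf_mono[of f x] unfolding P_def by simp
    \<comment> \<open>Half of \<open>e\<close> is kept in reserve: \<open>Sup P\<close> itself may
      lie in \<open>P\<close>, and \<open>Liminf_zero\<close> needs a strictly smaller exponent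
      outside \<open>P\<close>.\<close>
    have "Sup P + e / 2 \<notin> P"
      using cSup_upper[OF _ bdd, of "Sup P + e / 2"] \<open>e > 0\<close> by auto
    then have "Liminf at_top (\<lambda>t. ereal (\<bar>f t\<bar> / t powr (Sup P + e / 2))) \<noteq> \<infinity>"
      by (simp add: P_def)
    then show "Liminf at_top (\<lambda>t. ereal (\<bar>f t\<bar> / t powr (Sup P + e))) = 0"
      using \<open>e > 0\<close> by (intro Liminf_zero[of f "Sup P + e / 2"]) auto
  qed
  then show ?thesis by blast
qed

section \<open>Integration of power bounds\<close>

text \<open>With \<open>L = K / (r + 1)\<close>, the difference of \<open>g\<close> and
  \<open>L * t powr (r + 1)\<close> is eventually nondecreasing, hence bounded below. Halving
  \<open>L\<close> absorbs that bound, whatever the sign of \<open>g T\<close>.\<close>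

lemma powr_bound_integrate:
  fixes g g' :: "real \<Rightarrow> real"
  assumes "\<And>t. t > a \<Longrightarrow> (g has_real_derivative g' t) (at t)"
    and "K > 0" "r \<ge> 0" "eventually (\<lambda>t. K * t powr r \<le> g' t) at_top"
  shows "\<exists>K'>0. eventually (\<lambda>t. K' * t powr (r + 1) \<le> g t) at_top"
proof -
  obtain T0 where T0: "\<And>t. t \<ge> T0 \<Longrightarrow> K * t powr r \<le> g' t"
    using assms(4) by (auto simp: eventually_at_top_linorder)
  define T where "T = max T0 (max 1 (a + 1))"
  define L where "L = K / (r + 1)"
  have "L > 0" using assms(2,3) by (simp add: L_def)
  have mono: "g T - L * T powr (r + 1) \<le> g t - L * t powr (r + 1)" if "t \<ge> T" for t
  proof (rule DERIV_nonneg_imp_nondecreasing[OF that])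
    fix x assume "T \<le> x"
    then have x: "x > a" "x > 0" "x \<ge> T0" by (auto simp: T_def)
    have "((\<lambda>t. g t - L * t powr (r + 1)) has_real_derivative g' x - K * x powr r) (at x)"
      using x assms(3) by (auto intro!: derivative_eq_intros assms(1) simp: L_def)
    then show "\<exists>d. ((\<lambda>t. g t - L * t powr (r + 1)) has_real_derivative d) (at x) \<and> 0 \<le> d"
      using T0[OF x(3)] by (intro exI[of _ "g' x - K * x powr r"]) simp
  qed
  have "filterlim (\<lambda>t::real. t powr (r + 1)) at_top at_top"
    using real_powr_at_top assms(3) by simp
  then have "eventually (\<lambda>t. (2 / L) * (L * T powr (r + 1) - g T) \<le> t powr (r + 1)) at_top"
    by (simp add: filterlim_at_top)
  then have "eventually (\<lambda>t. L / 2 * t powr (r + 1) \<le> g t) at_top"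
    using eventually_ge_at_top[of T]
  proof eventually_elim
    case (elim t)
    have "L * T powr (r + 1) - g T \<le> L / 2 * t powr (r + 1)"
      using elim(1) \<open>L > 0\<close> by (simp add: field_simps)
    then show ?case using mono[OF elim(2)] by simp
  qed
  then show ?thesis using \<open>L > 0\<close> by (intro exI[of _ "L / 2"]) simp
qed

lemma powr_bound_iterated_integrate:
  fixes g :: "nat \<Rightarrow> real \<Rightarrow> real"
  assumes "\<And>j t. j < n \<Longrightarrow> t > a \<Longrightarrow> (g j has_real_derivative g (Suc j) t) (at t)"
    and "K > 0" "r \<ge> 0" "eventually (\<lambda>t. K * t powr r \<le> g n t) at_top"
    and "k \<le> n"
  shows "\<exists>K'>0. eventually (\<lambda>t. K' * t powr (r + real k) \<le> g (n - k) t) at_top"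
  using assms(5)
proof (induction k)
  case 0
  then show ?case using assms(2,4) by auto
next
  case (Suc k)
  then obtain L where L: "L > 0" "eventually (\<lambda>t. L * t powr (r + real k) \<le> g (n - k) t) at_top"
    by auto
  have "n - k = Suc (n - Suc k)" using Suc.prems by simp
  then have "(g (n - Suc k) has_real_derivative g (n - k) t) (at t)" if "t > a" for t
    using assms(1)[of "n - Suc k" t] that Suc.prems by simp
  from powr_bound_integrate[OF this L(1) _ L(2)] assms(3)
  show ?case by (simp add: algebra_simps)
qed

section \<open>Finite-time blow-up\<close>

text \<open>Taylor's formula with nonnegative derivatives bounds \<open>g 0 (s + h)\<close> below by
  \<open>g 0 s powr \<nu> * h ^ n / fact n\<close>. Steps of length
  \<open>h = 1, 1/2, 1/4, ...\<close> then force geometric growth on a bounded interval.\<close>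

lemma superlinear_ode_no_global_solution:
  fixes g :: "nat \<Rightarrow> real \<Rightarrow> real"
  assumes "n \<ge> 1" "\<nu> > 1"
    and deriv: "\<And>j t. j < n \<Longrightarrow> t > a \<Longrightarrow> (g j has_real_derivative g (Suc j) t) (at t)"
    and "\<And>j. j \<le> n \<Longrightarrow> eventually (\<lambda>t. g j t \<ge> 0) at_top"
    and "filterlim (g 0) at_top at_top"
    and "eventually (\<lambda>t. g 0 t powr \<nu> \<le> g n t) at_top"
  shows False
proof -
  \<comment> \<open>Solutions of \<open>B powr (\<nu> - 1) = 2 ^ n\<close> and
    \<open>A powr (\<nu> - 1) = B * fact n\<close>: the first offsets the shrinking factor
    \<open>h ^ n\<close>, the second cancels the factorial and leaves one extra factor
    \<open>B\<close>.\<close>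
  define B where "B = 2 powr (real n / (\<nu> - 1))"
  define A where "A = (B * fact n) powr (1 / (\<nu> - 1))"
  have "B > 1" "A > 0" using assms(1,2) by (auto simp: A_def B_def)
  have Bpow: "B powr (\<nu> - 1) = 2 ^ n"
    using assms(2) by (simp add: B_def powr_powr powr_realpow)
  have Apow: "A powr (\<nu> - 1) = B * fact n"
    using assms(2) \<open>B > 1\<close> by (simp add: A_def powr_powr)
  have "eventually (\<lambda>t. \<forall>j\<in>{..n}. g j t \<ge> 0) at_top"
    using assms(4) by (intro eventually_ball_finite) auto
  then have "eventually (\<lambda>t. (\<forall>j\<in>{..n}. g j t \<ge> 0) \<and> g 0 t \<ge> A \<and> g 0 t powr \<nu> \<le> g n t \<and> t > a) at_top"
    using assms(5,6) eventually_gt_at_top[of a] by (auto simp: filterlim_at_top eventually_conj_iff)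
  then obtain T where T: "\<And>t j. t \<ge> T \<Longrightarrow> j \<le> n \<Longrightarrow> g j t \<ge> 0" "\<And>t. t \<ge> T \<Longrightarrow> g 0 t \<ge> A"
      "\<And>t. t \<ge> T \<Longrightarrow> g 0 t powr \<nu> \<le> g n t" "\<And>t. t \<ge> T \<Longrightarrow> t > a"
    unfolding eventually_at_top_linorder by (metis atMost_iff)
  have mono: "g 0 s \<le> g 0 t" if "T \<le> s" "s \<le> t" for s t
  proof (rule DERIV_nonneg_imp_nondecreasing[OF that(2)])
    fix x assume "s \<le> x"
    then have "(g 0 has_real_derivative g 1 x) (at x)" "g 1 x \<ge> 0"
      using that(1) assms(1) deriv[of 0 x] T(1)[of x 1] T(4)[of x] by auto
    then show "\<exists>d. (g 0 has_real_derivative d) (at x) \<and> 0 \<le> d" by blast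
  qed
  have step: "g 0 s powr \<nu> * h ^ n / fact n \<le> g 0 (s + h)" if "T \<le> s" "h > 0" for s h
  proof -
    have "\<exists>x>s. x < s + h \<and> g 0 (s + h) =
        (\<Sum>m<n. g m s / fact m * (s + h - s) ^ m) + g n x / fact n * (s + h - s) ^ n"
    proof (rule Taylor_up[where a = s and b = "s + h"])
      show "\<forall>m t. m < n \<and> s \<le> t \<and> t \<le> s + h \<longrightarrow> (g m has_real_derivative g (Suc m) t) (at t)"
        using deriv T(4) that(1) by force
    qed (use assms(1) that in auto)
    then obtain x where x: "x > s" "g 0 (s + h) = (\<Sum>m<n. g m s / fact m * h ^ m) + g n x / fact n * h ^ n"
      by auto
    \<comment> \<open>Only the Lagrange remainder is kept; its point \<open>x\<close> lies beyond
      \<open>s\<close>, so monotonicity of \<open>g 0\<close> replaces \<open>x\<close> by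
      \<open>s\<close>.\<close>
    have "0 \<le> (\<Sum>m<n. g m s / fact m * h ^ m)"
      using that T(1) by (intro sum_nonneg) auto
    moreover have "g 0 s powr \<nu> \<le> g 0 x powr \<nu>"
      using mono[of s x] x(1) that(1) T(1)[of s 0] assms(2) by (intro powr_mono2) auto
    then have "g 0 s powr \<nu> \<le> g n x" using T(3)[of x] x(1) that(1) by simp
    then have "g 0 s powr \<nu> * h ^ n / fact n \<le> g n x / fact n * h ^ n"
      using that(2) by (simp add: divide_right_mono mult_right_mono)
    ultimately show ?thesis using x(2) by simp
  qed
  \<comment> \<open>the choice of \<open>A\<close> and \<open>B\<close> is such that this bound is preserved by \<open>step\<close>
    with \<open>h = 2\<^sup>-\<^sup>k\<close>, while the arguments stay below \<open>T + 2\<close>\<close>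
  have bound: "A * B ^ k \<le> g 0 (T + 2 - 2 * (1 / 2) ^ k)" for k
  proof (induction k)
    case 0
    then show ?case using T(2)[of T] by simp
  next
    case (Suc k)
    define s where "s = T + 2 - 2 * (1 / 2 :: real) ^ k"
    have "(1 / 2 :: real) ^ k \<le> 1" by (simp add: power_le_one)
    then have "s \<ge> T" by (simp add: s_def)
    have pos: "A * B ^ k > 0" using \<open>A > 0\<close> \<open>B > 1\<close> by simp
    have "(A * B ^ k) powr \<nu> = (A * B ^ k) powr (1 + (\<nu> - 1))" by simp
    also have "\<dots> = (A * B ^ k) * (A * B ^ k) powr (\<nu> - 1)"
      using pos unfolding powr_add by simp
    also have "(A * B ^ k) powr (\<nu> - 1) = A powr (\<nu> - 1) * (B powr (\<nu> - 1)) ^ k"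
      using \<open>A > 0\<close> \<open>B > 1\<close> by (simp add: powr_mult powr_powr mult.commute flip: powr_realpow)
    finally have "(A * B ^ k) powr \<nu> = A * B ^ k * (B * fact n * (2 ^ n) ^ k)"
      unfolding Apow Bpow .
    then have "A * B ^ Suc k = (A * B ^ k) powr \<nu> * ((1 / 2) ^ k) ^ n / fact n"
      by (simp add: power_divide power_mult[symmetric] mult.commute)
    also have "\<dots> \<le> g 0 s powr \<nu> * ((1 / 2) ^ k) ^ n / fact n"
      using Suc.IH pos assms(2) unfolding s_def[symmetric]
      by (intro divide_right_mono mult_right_mono powr_mono2) auto
    also have "\<dots> \<le> g 0 (s + (1 / 2) ^ k)"
      using step[OF \<open>s \<ge> T\<close>] by simp
    also have "s + (1 / 2) ^ k = T + 2 - 2 * (1 / 2) ^ Suc k"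
      by (simp add: s_def)
    finally show ?case .
  qed
  \<comment> \<open>All points in \<open>bound\<close> lie below \<open>T + 2\<close>, so
    \<open>g 0 (T + 2)\<close> would exceed every \<open>A * B ^ k\<close>.\<close>
  obtain k where "g 0 (T + 2) / A < B ^ k"
    using real_arch_pow[OF \<open>B > 1\<close>] by blast
  then have "g 0 (T + 2) < A * B ^ k" using \<open>A > 0\<close> by (simp add: field_simps)
  also note bound[of k]
  also have "g 0 (T + 2 - 2 * (1 / 2) ^ k) \<le> g 0 (T + 2)"
    by (rule mono) (auto simp: power_le_one)
  finally show False by simp
qed

section \<open>Regularity, constant sign and choice of sequences\<close>

text \<open>Away from the endpoint \<open>a\<close> the derivative within the half-line is the
  ordinary two-sided one.\<close>

lemma C_n_on_has_derivative:
  assumes "C_n_on a n y" "j < n" "t > a"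
  shows "(nth_deriv_on a j y has_real_derivative nth_deriv_on a (Suc j) y t) (at t)"
proof -
  have "nth_deriv_on a j y differentiable (at t within {a..})"
    using assms by (auto simp: C_n_on_def differentiable_on_def)
  then have "(nth_deriv_on a j y has_vector_derivative nth_deriv_on a (Suc j) y t) (at t within {a..})"
    by (simp add: vector_derivative_works)
  moreover have "at t within {a..} = at t"
    using assms(3) by (intro at_within_interior) simp
  ultimately show ?thesis
    by (simp add: has_real_derivative_iff_has_vector_derivative)
qed

lemma C_n_on_imp_continuous_on:
  assumes "C_n_on a n y"
  shows "continuous_on {a..} y"
proof (cases n)
  case (Suc m)
  then have "nth_deriv_on a 0 y differentiable_on {a..}"
    using assms unfolding C_n_on_def by blast
  then show ?thesis by (simp add: differentiable_imp_continuous_on)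
qed (use assms in \<open>simp add: C_n_on_def\<close>)

text \<open>The image of a half-line is connected and omits 0. Recording the sign as a factor
  \<open>\<sigma>\<close> lets one argument treat both signs.\<close>

lemma continuous_abs_ge_constant_sign:
  fixes g :: "real \<Rightarrow> real"
  assumes "continuous_on {T..} g" "d > 0" "\<And>t. t \<ge> T \<Longrightarrow> d \<le> \<bar>g t\<bar>"
  obtains \<sigma> where "\<bar>\<sigma>\<bar> = 1" "\<And>t. t \<ge> T \<Longrightarrow> d \<le> \<sigma> * g t"
proof -
  have "connected (g ` {T..})"
    using assms(1) by (intro connected_continuous_image) auto
  moreover have "0 \<notin> g ` {T..}" using assms(2,3) by force
  ultimately have sign: "\<not> (g s \<le> 0 \<and> 0 \<le> g t)" if "s \<ge> T" "t \<ge> T" for s t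
    using connectedD_interval[of "g ` {T..}" "g s" "g t" 0] that by auto
  show thesis
  proof (cases "g T > 0")
    case True
    then have "d \<le> 1 * g t" if "t \<ge> T" for t
      using sign[of t T] assms(3)[of t] that True by (auto simp: abs_if split: if_splits)
    then show thesis by (intro that[of 1]) auto
  next
    case False
    then have "d \<le> - 1 * g t" if "t \<ge> T" for t
      using sign[of T t] assms(3)[of t] that False by (auto simp: abs_if split: if_splits)
    then show thesis by (intro that[of "- 1"]) auto
  qed
qed

lemma frequently_small_sequence:
  fixes g :: "real \<Rightarrow> real"
  assumes "\<And>d N. d > 0 \<Longrightarrow> \<exists>t\<ge>N. \<bar>g t\<bar> < d"
  shows "\<exists>s :: nat \<Rightarrow> real. strict_mono s \<and> (\<forall>k. a \<le> s k) \<and>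
           filterlim s at_top sequentially \<and> (\<lambda>k. g (s k)) \<longlonglongrightarrow> 0"
proof -
  have "\<exists>s. \<forall>k. (max a (real k) \<le> s k \<and> \<bar>g (s k)\<bar> < inverse (real (Suc k))) \<and> s k < s (Suc k)"
  proof (rule dependent_nat_choice)
    show "\<exists>x. max a (real 0) \<le> x \<and> \<bar>g x\<bar> < inverse (real (Suc 0))"
      using assms[of 1 "max a 0"] by auto
    fix x :: real and k :: nat
    show "\<exists>z. (max a (real (Suc k)) \<le> z \<and> \<bar>g z\<bar> < inverse (real (Suc (Suc k)))) \<and> x < z"
    proof -
      have "0 < inverse (real (Suc (Suc k)))" by simp
      \<comment> \<open>The three lower bounds keep the point in the domain, make the sequence
        diverge, and make it strictly increasing.\<close>
      from assms[OF this, of "max (max a (real (Suc k))) (x + 1)"] obtain z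
        where z: "max (max a (real (Suc k))) (x + 1) \<le> z" "\<bar>g z\<bar> < inverse (real (Suc (Suc k)))"
        by blast
      from z(1) have "max a (real (Suc k)) \<le> z" "x < z" by (auto simp only: max.bounded_iff)
      with z(2) show ?thesis by blast
    qed
  qed
  then obtain s where s: "\<And>k. max a (real k) \<le> s k" "\<And>k. \<bar>g (s k)\<bar> < inverse (real (Suc k))"
      "\<And>k. s k < s (Suc k)"
    by blast
  have "strict_mono s" using s(3) by (simp add: strict_mono_Suc_iff)
  moreover have "filterlim s at_top sequentially"
    using s(1) by (intro filterlim_at_top_mono[OF filterlim_real_sequentially]) auto
  moreover have "(\<lambda>k. g (s k)) \<longlonglongrightarrow> 0"
    using s(2) by (intro tendsto_0_le[OF LIMSEQ_inverse_real_of_nat, where K = 1]) (auto intro!: always_eventually less_imp_le)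
  moreover have "a \<le> s k" for k using s(1)[of k] by simp
  ultimately show ?thesis by blast
qed

section \<open>Excluding a top derivative bounded away from zero\<close>

theorem theorem3:
  fixes n :: nat and t0 :: real and F :: "real \<Rightarrow> real \<Rightarrow> real"
    and \<nu> \<mu> c a :: real and y :: "real \<Rightarrow> real"
  assumes "n \<ge> 1"
    and "continuous_on ({t0..} \<times> UNIV) (\<lambda>(t, x). F t x)"
    and "\<nu> > 1"
    and "\<And>f. f \<in> S1 \<Longrightarrow> (\<lambda>t. F t (f t) / \<bar>f t\<bar> powr \<nu>) \<in> S1"
    and "\<mu> > 1"
    and "c > - real n"
    and "\<And>f. f \<in> S3 \<Longrightarrow> (\<lambda>t. F t (f t)) \<in> S3 \<and>
           growth_exponent (\<lambda>t. F t (f t)) \<ge> ereal \<mu> * growth_exponent f + ereal c"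
    and "ode_solution n t0 F a y"
  shows "\<exists>i\<le>n. \<forall>j. i \<le> j \<and> j \<le> n \<longrightarrow>
           (\<exists>s :: nat \<Rightarrow> real. strict_mono s \<and> (\<forall>k. a \<le> s k) \<and>
              filterlim s at_top sequentially \<and>
              (\<lambda>k. nth_deriv_on a j y (s k)) \<longlonglongrightarrow> 0)"
proof -
  let ?D = "\<lambda>j. nth_deriv_on a j y"
  have C: "C_n_on a n y" and ode: "\<And>t. t \<ge> a \<Longrightarrow> ?D n t = F t (y t)"
    using assms(8) by (auto simp: ode_solution_def)
  have "\<exists>t\<ge>N. \<bar>?D n t\<bar> < d" if "d > 0" for d N
  proof (rule ccontr)
    assume "\<not> ?thesis"
    then have large: "d \<le> \<bar>?D n t\<bar>" if "t \<ge> max N a" for t using that by force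
    have "continuous_on {max N a..} (?D n)"
      using C unfolding C_n_on_def by (auto intro: continuous_on_subset)
    from continuous_abs_ge_constant_sign[OF this \<open>d > 0\<close> large]
    obtain \<sigma> where \<sigma>: "\<bar>\<sigma>\<bar> = 1" "\<And>t. t \<ge> max N a \<Longrightarrow> d \<le> \<sigma> * ?D n t"
      by blast
    \<comment> \<open>Only the derivatives are multiplied by \<open>\<sigma>\<close>; the equation
      is not transformed. The hypotheses on \<open>F\<close> are applied to \<open>y\<close> itself,
      and \<open>abs_g\<close> and \<open>gn_eq\<close> transfer the estimates through absolute
      values.\<close>
    define g where "g = (\<lambda>j t. \<sigma> * ?D j t)"
    have abs_g: "\<bar>g 0 t\<bar> = \<bar>y t\<bar>" for t using \<sigma>(1) by (simp add: g_def abs_mult)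
    have gn_eq: "g n t = \<bar>F t (y t)\<bar>" if "t \<ge> max N a" for t
    proof -
      have "g n t = \<bar>g n t\<bar>" using \<sigma>(2)[OF that] \<open>d > 0\<close> by (simp add: g_def)
      also have "\<dots> = \<bar>F t (y t)\<bar>" using \<sigma>(1) ode[of t] that by (simp add: g_def abs_mult)
      finally show ?thesis .
    qed
    have deriv: "(g j has_real_derivative g (Suc j) t) (at t)" if "j < n" "t > a" for j t
      unfolding g_def by (intro DERIV_cmult C_n_on_has_derivative[OF C that])
    \<comment> \<open>The constant bound is read as a power bound of exponent 0, the start of the
      iterated integration.\<close>
    have gn_ge: "eventually (\<lambda>t. d * t powr 0 \<le> g n t) at_top"
      using eventually_ge_at_top[of "max N a"] eventually_gt_at_top[of 0]
      by eventually_elim (use \<sigma>(2) in \<open>simp add: g_def\<close>)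
    have iter: "\<exists>K>0. eventually (\<lambda>t. K * t powr real k \<le> g (n - k) t) at_top" if "k \<le> n" for k
      using powr_bound_iterated_integrate[of n a g d 0 k] deriv \<open>d > 0\<close> gn_ge that by simp
    have g_pos: "eventually (\<lambda>t. g j t \<ge> 0) at_top" if jn: "j \<le> n" for j
    proof -
      obtain K where "K > 0" "eventually (\<lambda>t. K * t powr real (n - j) \<le> g j t) at_top"
        using iter[of "n - j"] diff_diff_cancel[OF jn] by auto
      from this(2) show ?thesis
        by (rule eventually_mono) (meson \<open>K > 0\<close> less_imp_le mult_nonneg_nonneg order.trans powr_ge_zero)
    qed
    obtain K where K: "K > 0" "eventually (\<lambda>t. K * t powr real n \<le> g 0 t) at_top"
      using iter[of n] by auto
    then have K': "eventually (\<lambda>t. K * t powr real n \<le> \<bar>y t\<bar>) at_top"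
      by (auto elim!: eventually_mono simp flip: abs_g)
    have y_Liminf: "Liminf at_top (\<lambda>t. ereal (\<bar>y t\<bar> / t powr s)) = \<infinity>" if "s < real n" for s
      using powr_bound_imp_Liminf[OF K(1) K' that] .
    have cont: "eventually_continuous y"
      using C_n_on_imp_continuous_on[OF C] by (auto simp: eventually_continuous_def)
    \<comment> \<open>Exponent 0 already rules out \<open>S2\<close>, because \<open>0 < n\<close>
      makes the lower limit infinite there.\<close>
    have "Limsup at_top (\<lambda>t. ereal (\<bar>y t\<bar> / t powr 0)) = \<infinity>"
      using y_Liminf[of 0] assms(1) Liminf_le_Limsup[of at_top "\<lambda>t. ereal (\<bar>y t\<bar> / t powr 0)"]
      by simp
    moreover have "Limsup at_top (\<lambda>t. ereal (\<bar>y t\<bar> / t powr 0)) = 0" if "y \<in> S2"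
      using that unfolding S2_def by blast
    ultimately have "y \<notin> S2" by auto
    then consider "y \<in> S1" | "y \<in> S3" using cont by (auto simp: S3_def)
    then show False
    proof cases
      case 1
      \<comment> \<open>The instance \<open>p = 0\<close> suffices: the quotient is eventually at
        least 1 in absolute value, which is the superlinear inequality for \<open>g\<close>.\<close>
      then have "Liminf at_top (\<lambda>t. ereal (\<bar>F t (y t) / \<bar>y t\<bar> powr \<nu>\<bar> / t powr 0)) = \<infinity>"
        using assms(4) unfolding S1_def by blast
      from Liminf_imp_powr_bound[OF this]
      have "eventually (\<lambda>t. g 0 t powr \<nu> \<le> g n t) at_top"
        using eventually_ge_at_top[of "max N a"] eventually_gt_at_top[of 0] K(2)
      proof eventually_elim
        case (elim t)
        have "0 < K * t powr real n" using K(1) elim(3) by simp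
        then have "g 0 t > 0" using elim(4) by linarith
        then have "\<bar>y t\<bar> = g 0 t" using abs_g[of t] by simp
        then show ?case
          using elim(1,3) \<open>g 0 t > 0\<close> gn_eq[OF elim(2)] by (simp add: abs_divide field_simps)
      qed
      moreover have "filterlim (g 0) at_top at_top"
      proof (rule filterlim_at_top_mono[OF _ K(2)])
        have "filterlim (\<lambda>t::real. t powr real n) at_top at_top"
          using real_powr_at_top assms(1) by simp
        then show "filterlim (\<lambda>t. K * t powr real n) at_top at_top"
          using K(1) filterlim_tendsto_pos_mult_at_top[OF tendsto_const] by blast
      qed
      ultimately show False
        using superlinear_ode_no_global_solution[where g = g and n = n, OF assms(1,3) deriv g_pos] by blast
    next
      case 2
      then obtain p' where "Liminf at_top (\<lambda>t. ereal (\<bar>y t\<bar> / t powr p')) \<noteq> \<infinity>"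
        using cont by (auto simp: S3_def S1_def)
      then obtain q where q: "has_growth_exponent y q"
        using has_growth_exponent_exists[OF y_Liminf[of 0]] assms(1) by auto
      \<comment> \<open>Used twice: with \<open>s = n\<close> for the initial lower bound on
        \<open>q\<close>, and at the end with \<open>s = r + n\<close> for the
        contradiction.\<close>
      have q_ge: "s \<le> q" if "\<And>r. r < s \<Longrightarrow> Liminf at_top (\<lambda>t. ereal (\<bar>y t\<bar> / t powr r)) = \<infinity>" for s
      proof (rule ccontr)
        assume "\<not> s \<le> q"
        then obtain e where "e > 0" "q + e < s"
          using dense[of 0 "s - q"] by (auto simp: less_diff_eq algebra_simps)
        moreover from this have "Liminf at_top (\<lambda>t. ereal (\<bar>y t\<bar> / t powr (q + e))) = 0"
          using q unfolding has_growth_exponent_def by blast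
        ultimately show False using that[of "q + e"] by simp
      qed
      then have "real n \<le> q" using y_Liminf by blast
      have "ereal (\<mu> * q + c) \<le> growth_exponent (\<lambda>t. F t (y t))"
        using assms(7)[OF 2] growth_exponent_eq[OF q] by simp
      \<comment> \<open>A real lower bound excludes the value \<open>- \<infinity>\<close>, so the
        exponent of the right-hand side is a genuine number.\<close>
      moreover from this obtain q' where q': "has_growth_exponent (\<lambda>t. F t (y t)) q'"
        unfolding growth_exponent_def by (auto split: if_splits)
      ultimately have "\<mu> * q + c \<le> q'" by (simp add: growth_exponent_eq)
      \<comment> \<open>Since \<open>q\<close> is nonnegative,
        \<open>\<mu> * q + c \<ge> q + c > q - n\<close>. This leaves room for an \<open>r\<close>
        below \<open>q'\<close> that exceeds \<open>q\<close> after \<open>n\<close> integrations;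
        \<open>q \<ge> n\<close> also makes \<open>r\<close> positive, as the integration lemma
        requires.\<close>
      have "0 \<le> (\<mu> - 1) * q" using \<open>real n \<le> q\<close> assms(5) by simp
      then have "q - real n < \<mu> * q + c" using assms(6) by (simp add: algebra_simps)
      then obtain r where r: "q - real n < r" "r < q'"
        using dense[of "q - real n" q'] \<open>\<mu> * q + c \<le> q'\<close> by auto
      \<comment> \<open>The exponent \<open>r\<close> is written so as to match the definition with
        \<open>\<epsilon> = q' - r\<close>.\<close>
      have "Liminf at_top (\<lambda>t. ereal (\<bar>F t (y t)\<bar> / t powr (q' - (q' - r)))) = \<infinity>"
        using q' r(2) unfolding has_growth_exponent_def by (metis diff_gt_0_iff_gt)
      then have "eventually (\<lambda>t. t powr r \<le> \<bar>F t (y t)\<bar>) at_top"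
        using Liminf_imp_powr_bound[of "\<lambda>t. F t (y t)" r] by simp
      then have "eventually (\<lambda>t. 1 * t powr r \<le> g n t) at_top"
        using eventually_ge_at_top[of "max N a"] by eventually_elim (simp add: gn_eq)
      then obtain L where L: "L > 0" "eventually (\<lambda>t. L * t powr (r + real n) \<le> g 0 t) at_top"
        using powr_bound_iterated_integrate[of n a g 1 r n] deriv r(1) \<open>real n \<le> q\<close> by auto
      from L(2) have "eventually (\<lambda>t. L * t powr (r + real n) \<le> \<bar>y t\<bar>) at_top"
        by (auto elim!: eventually_mono simp flip: abs_g)
      from powr_bound_imp_Liminf[OF L(1) this] have "r + real n \<le> q"
        by (rule q_ge)
      then show False using r(1) by simp
    qed
  qed
  from frequently_small_sequence[OF this]
  show ?thesis by (intro exI[of _ n]) auto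
qed

end
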